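(* Let $n\equiv1\pmod 2$. The solutions $X\in M_n(\mathbb{C})$ of $X^tA_n+A_nX=0$ are exactly the matrices of the following form, for arbitrary parameters $x_0,x_1,\dots,x_{(n-1)/2}\in\mathbb{C}$: - $X_{ii}=x_0$ for $i$ odd and $X_{ii}=-x_0$ for $i$ even; - $X_{ij}=x_{(j-i+1)/2}$ for $i$ odd, $j$ even, $i<j$; - $X_{ij}=-x_{(i-j+1)/2}$ for $i$ odd, $j$ even, $i>j$; - $X_{ij}=0$ in all other cases.
   Context: $A_n$ is the $n\times n$ matrix with $(A_n)_{i,i+1}=1$ for $1\le i\le n-1$ and all other entries $0$. *)

theory Defs
  imports Complex_Main "Jordan_Normal_Form.Matrix"
begin

(* Entries of type mat are indexed from 0, so the entry written X_{ij} (1 <= i, j <= n)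
   in the mathematics is X $$ (i - 1, j - 1). *)

definition A_mat :: "nat \<Rightarrow> complex mat" where
  "A_mat n = mat n n (\<lambda>(i, j). if j = i + 1 then 1 else 0)"

(* Entry in row i and column j, both counted from 1; x lists the parameters
   x_0, x_1, ..., x_{(n-1)/2}. In the branches using div the dividend is even,
   and no natural-number subtraction truncates. *)
definition sol_entry :: "complex vec \<Rightarrow> nat \<Rightarrow> nat \<Rightarrow> complex" where
  "sol_entry x i j =
    (if i = j \<and> odd i then x $ 0
     else if i = j \<and> even i then - (x $ 0)
     else if odd i \<and> even j \<and> i < j then x $ ((j - i + 1) div 2)
     else if odd i \<and> even j \<and> i > j then - (x $ ((i - j + 1) div 2))
     else 0)"

definition sol_mat :: "nat \<Rightarrow> complex vec \<Rightarrow> complex mat" where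
  "sol_mat n x = mat n n (\<lambda>(i, j). sol_entry x (i + 1) (j + 1))"

end

(* With indices counted from 1 (the lemmas count from 0), the equation says that
   X(a, b) = -X(b + 1, a + 1), and that the first column and the last column of X vanish off the diagonal. Hence X is invariant under diagonal shifts by (2, 2).
   For n odd, shifting moves every entry of an odd column to the first or the last column, so
   such entries vanish off the diagonal; the antisymmetry extends this to entries
   with both indices even. The remaining entries are determined by the first row. *)

theory Submission
  imports Defs
begin

lemma transpose_times_A_mat_index:
  assumes X: "X \<in> carrier_mat n n" and i: "i < n" and j: "j < n"
  shows "(transpose_mat X * A_mat n) $$ (i, j) = (if j = 0 then 0 else X $$ (j - 1, i))"
proof -
  have "(transpose_mat X * A_mat n) $$ (i, j)
      = (\<Sum>k = 0..<n. if j = k + 1 then X $$ (k, i) else 0)"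
    using assms by (auto simp: A_mat_def scalar_prod_def intro!: sum.cong)
  also have "\<dots> = (if j = 0 then 0 else X $$ (j - 1, i))"
    using j by (cases j) (auto simp: sum.delta')
  finally show ?thesis .
qed

lemma A_mat_times_index:
  assumes X: "X \<in> carrier_mat n n" and i: "i < n" and j: "j < n"
  shows "(A_mat n * X) $$ (i, j) = (if i + 1 < n then X $$ (i + 1, j) else 0)"
proof -
  have "(A_mat n * X) $$ (i, j) = (\<Sum>k = 0..<n. if k = i + 1 then X $$ (k, j) else 0)"
    using assms by (auto simp: A_mat_def scalar_prod_def
        if_distrib[where f = "\<lambda>c. c * z" for z] cong: if_cong)
  also have "\<dots> = (if i + 1 < n then X $$ (i + 1, j) else 0)"
    by (auto simp: sum.delta)
  finally show ?thesis .
qed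

text \<open>Right multiplication by \<open>A_mat n\<close> shifts columns to the right, left
  multiplication shifts rows up. The zeros shifted in at the border yield the conditions on the
  first and last columns of X.\<close>

lemma A_mat_equation_iff:
  assumes X: "X \<in> carrier_mat n n"
  shows "transpose_mat X * A_mat n + A_mat n * X = 0\<^sub>m n n \<longleftrightarrow>
    (\<forall>i<n. \<forall>j<n. (if j = 0 then 0 else X $$ (j - 1, i))
                   + (if i + 1 < n then X $$ (i + 1, j) else 0) = 0)"
    (is "?M = _ \<longleftrightarrow> _")
proof -
  have A: "A_mat n \<in> carrier_mat n n" by (simp add: A_mat_def)
  have M: "?M \<in> carrier_mat n n" using X A by simp
  have "?M = 0\<^sub>m n n \<longleftrightarrow> (\<forall>i<n. \<forall>j<n. ?M $$ (i, j) = 0)"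
    using M by (auto simp: mat_eq_iff)
  moreover have "?M $$ (i, j) = (if j = 0 then 0 else X $$ (j - 1, i))
      + (if i + 1 < n then X $$ (i + 1, j) else 0)" if "i < n" "j < n" for i j
    using that X A transpose_times_A_mat_index[OF X that] A_mat_times_index[OF X that]
    by (subst index_add_mat) auto
  ultimately show ?thesis by simp
qed

text \<open>Passing from (a, b) to (b + 1, a + 1) keeps an odd row with an even column but reverses
  the sign of column minus row, so the two off-diagonal branches trade places with the same
  parameter. On the diagonal the parity flips.\<close>

lemma sol_entry_antisym:
  assumes "0 < a" "0 < b"
  shows "sol_entry x a b = - sol_entry x (b + 1) (a + 1)"
  using assms by (auto simp: sol_entry_def)

lemma sol_mat_satisfies_equation:
  assumes "odd n"
  shows "transpose_mat (sol_mat n x) * A_mat n + A_mat n * sol_mat n x = 0\<^sub>m n n"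
proof -
  have carrier: "sol_mat n x \<in> carrier_mat n n" by (simp add: sol_mat_def)
  have index: "sol_mat n x $$ (i, j) = sol_entry x (i + 1) (j + 1)" if "i < n" "j < n" for i j
    using that by (simp add: sol_mat_def)
  have "(if j = 0 then 0 else sol_mat n x $$ (j - 1, i))
      + (if i + 1 < n then sol_mat n x $$ (i + 1, j) else 0) = 0"
    if i: "i < n" and j: "j < n" for i j
  proof (cases "j = 0")
    case True
    then show ?thesis using i index by (simp add: sol_entry_def)
  next
    case j0: False
    show ?thesis
    proof (cases "i + 1 < n")
      case True
      then show ?thesis
        using i j j0 index sol_entry_antisym[of j "i + 1" x] by simp
    next
      case False
      then have "i + 1 = n" using i by simp
      \<comment> \<open>Only the entry with 1-based position (j, n) remains. It is off the diagonal
        in an odd column, hence zero; here the parity of n enters.\<close>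
      then show ?thesis using i j j0 assms index[of "j - 1" i]
        by (auto simp: sol_entry_def)
    qed
  qed
  then show ?thesis using A_mat_equation_iff[OF carrier] by blast
qed

text \<open>The parameters are read off the first row: for k > 0, \<open>x $ k\<close> is the entry
  in 1-based column 2k, hence the 0-based \<open>2 * k - 1\<close>.\<close>

lemma equation_imp_sol_mat:
  assumes n: "odd n" and X: "X \<in> carrier_mat n n"
    and eq: "transpose_mat X * A_mat n + A_mat n * X = 0\<^sub>m n n"
  defines "x \<equiv> vec ((n - 1) div 2 + 1) (\<lambda>k. if k = 0 then X $$ (0, 0) else X $$ (0, 2 * k - 1))"
  shows "X = sol_mat n x"
proof -
  have E: "(if j = 0 then 0 else X $$ (j - 1, i))
      + (if i + 1 < n then X $$ (i + 1, j) else 0) = 0" if "i < n" "j < n" for i j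
    using A_mat_equation_iff[OF X] eq that by blast
  have anti: "X $$ (a, b) = - X $$ (b + 1, a + 1)" if "a + 1 < n" "b + 1 < n" for a b
    using E[of b "a + 1"] that by (simp add: eq_neg_iff_add_eq_0)
  have first_col: "X $$ (a, 0) = 0" if "0 < a" "a < n" for a
    using E[of "a - 1" 0] that by simp
  have last_col: "X $$ (a, n - 1) = 0" if "a + 1 < n" for a
    using E[of "n - 1" "a + 1"] that by simp
  have shift: "X $$ (a + 2 * k, b + 2 * k) = X $$ (a, b)"
    if "a + 2 * k < n" "b + 2 * k < n" for a b k
    using that
  proof (induction k)
    case (Suc k)
    have "X $$ (a + 2 * k, b + 2 * k) = X $$ (a + 2 * k + 2, b + 2 * k + 2)"
      using anti[of "a + 2 * k" "b + 2 * k"] anti[of "b + 2 * k + 1" "a + 2 * k + 1"] Suc.prems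
      by simp
    then show ?case using Suc by simp
  qed simp
  have even_col_zero: "X $$ (a, b) = 0" if "even b" "a \<noteq> b" "a < n" "b < n" for a b
  proof (cases "b < a")
    case True
    obtain k where "b = 2 * k" using \<open>even b\<close> by blast
    then show ?thesis using shift[of "a - b" k 0] first_col[of "a - b"] that True by simp
  next
    case False
    \<comment> \<open>Above the diagonal the shift goes down to the last column, reachable because b
      and n - 1 are both even; a < b keeps the row below n - 1.\<close>
    have "even (n - 1 - b)" using n \<open>even b\<close> \<open>b < n\<close> by simp
    then obtain l where l: "n - 1 - b = 2 * l" by blast
    then have "b + 2 * l = n - 1" using that by simp
    then show ?thesis using shift[of a l b] last_col[of "a + 2 * l"] that False by simp
  qed
  have upper: "X $$ (a, b) = X $$ (0, b - a)" if "even a" "a \<le> b" "b < n" for a b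
  proof -
    obtain k where "a = 2 * k" using \<open>even a\<close> by blast
    then show ?thesis using shift[of 0 k "b - a"] that by simp
  qed
  have x_0: "x $ 0 = X $$ (0, 0)" by (simp add: x_def)
  have x_pos: "x $ ((d + 1) div 2) = X $$ (0, d)" if "odd d" "d < n" for d
  proof -
    obtain k where k: "d = 2 * k + 1" using \<open>odd d\<close> by (rule oddE)
    \<comment> \<open>Now d < n gives k < m, so the index k + 1 is within the dimension m + 1 of
      \<open>x\<close>.\<close>
    obtain m where m: "n = 2 * m + 1" using n by (rule oddE)
    show ?thesis using \<open>d < n\<close> by (simp add: x_def k m)
  qed
  have main: "X $$ (a, b) = sol_entry x (a + 1) (b + 1)" if a: "a < n" and b: "b < n" for a b
  proof -
    \<comment> \<open>Parities of 0-based indices are opposite to those in \<open>sol_entry\<close>: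
      \<open>above\<close> and \<open>below\<close> are its branches with odd row and even
      column.\<close>
    consider (diag_even) "a = b" "even a" | (diag_odd) "a = b" "odd a"
      | (even_col) "a \<noteq> b" "even b" | (both_odd) "a \<noteq> b" "odd a" "odd b"
      | (above) "even a" "odd b" "a < b" | (below) "even a" "odd b" "b < a"
      by (metis linorder_neqE_nat)
    then show ?thesis
    proof cases
      case diag_even
      then show ?thesis using upper[of a a] b by (simp add: sol_entry_def x_0)
    next
      case diag_odd
      then have "X $$ (a - 1, a - 1) = - X $$ (a, a)"
        using anti[of "a - 1" "a - 1"] a by (simp add: odd_pos)
      moreover have "X $$ (a - 1, a - 1) = X $$ (0, 0)"
        using upper[of "a - 1" "a - 1"] diag_odd a by simp
      ultimately show ?thesis using diag_odd
        by (simp add: sol_entry_def x_0 minus_equation_iff)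
    next
      case even_col
      then show ?thesis using even_col_zero a b
        by (simp add: sol_entry_def)
    next
      case both_odd
      \<comment> \<open>The last index n - 1 is even, so an odd index is never the last one.\<close>
      have "a + 1 < n" "b + 1 < n"
        using n both_odd a b by presburger+
      then have "X $$ (a, b) = 0"
        using anti[of a b] even_col_zero[of "a + 1" "b + 1"]
          both_odd by simp
      then show ?thesis using both_odd by (simp add: sol_entry_def)
    next
      case above
      then show ?thesis using upper[of a b] x_pos[of "b - a"] b by (simp add: sol_entry_def)
    next
      case below
      \<comment> \<open>Antisymmetry carries the entry above the diagonal into the even row b - 1,
        at the same distance a - b, where \<open>upper\<close> applies.\<close>
      then have "0 < b" by (simp add: odd_pos)
      then have "X $$ (a, b) = - X $$ (b - 1, a - 1)"
        using anti[of "b - 1" "a - 1"] a b below by simp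
      moreover have "X $$ (b - 1, a - 1) = X $$ (0, a - b)"
        using upper[of "b - 1" "a - 1"] below a \<open>0 < b\<close> by simp
      moreover have "x $ ((a - b + 1) div 2) = X $$ (0, a - b)"
        using x_pos[of "a - b"] below a by simp
      ultimately show ?thesis using below by (simp add: sol_entry_def)
    qed
  qed
  show ?thesis
    using X main by (intro eq_matI) (auto simp: sol_mat_def)
qed

theorem lemma4p1:
  fixes n :: nat
  assumes "n mod 2 = 1"
  shows "{X \<in> carrier_mat n n. transpose_mat X * A_mat n + A_mat n * X = 0\<^sub>m n n}
       = {sol_mat n x | x. x \<in> carrier_vec ((n - 1) div 2 + 1)}"
proof -
  have n: "odd n" using assms by presburger
  have "sol_mat n x \<in> carrier_mat n n" for x by (simp add: sol_mat_def)
  then show ?thesis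
    using sol_mat_satisfies_equation[OF n] equation_imp_sol_mat[OF n] vec_carrier by blast
qed

end
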